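(* Let $w$ be a weight vector and let $A_1,A_2\subset S=\mathbb{K}[x_1,\dots,x_n]$ be sets of monomials. Put $I_1=\overline{A_1}$ and $I_2=\overline{A_2}$. Then $I_1+I_2=\overline{A_1\cup A_2}$.
   Context: Let $\mathbb{K}$ be a field, $S=\mathbb{K}[x_1,\dots,x_n]$, $R=\mathbb{K}[y_1,\dots,y_n]$. A weight vector is $w=(w_1,\dots,w_n)$ of positive integers with $w_1\ge w_2\ge\dots\ge w_n$. Let $\psi:S\to R$ be the $\mathbb{K}$-algebra homomorphism with $\psi(x_i)=y_i^{w_i}$. A Borel move on a monomial $m\in R$ sends $m$ to $m\cdot\frac{y_{i_1}}{y_{j_1}}\cdots\frac{y_{i_s}}{y_{j_s}}$, where $i_t<j_t$ for all $t$ and $y_{j_1}\cdots y_{j_s}$ divides $m$. A monomial ideal of $R$ is strongly stable if it is closed under Borel moves on its monomials. For a set $T$ of monomials of $R$, $Borel(T)$ is the smallest strongly stable ideal containing $T$. For a set $A$ of monomials of $S$, $\overline{A}:=\psi^{-1}(Borel(\psi(A)))$, an ideal of $S$. *)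

theory Defs
  imports Complex_Main "HOL-Library.Poly_Mapping" "HOL-Library.Set_Algebras"
begin

text \<open>
  A polynomial ring in finitely many ordered variables. The variables are indexed by a finite
  linearly ordered type \<open>'n\<close>, which plays the role of \<open>1 < 2 < \<dots> < n\<close>. The two rings
  \<open>S\<close> and \<open>R\<close> are two copies of this ring, so \<open>poly_var i\<close> stands for \<open>x\<^sub>i\<close> as well as
  for \<open>y\<^sub>i\<close>.
\<close>

type_synonym ('n, 'k) polynomial = "('n \<Rightarrow>\<^sub>0 nat) \<Rightarrow>\<^sub>0 'k"

definition poly_const :: "'k::field \<Rightarrow> ('n, 'k) polynomial" where
  "poly_const c = Poly_Mapping.single 0 c"

definition poly_var :: "'n \<Rightarrow> ('n, 'k::field) polynomial" where
  "poly_var i = Poly_Mapping.single (Poly_Mapping.single i 1) 1"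

definition monomials :: "('n, 'k::field) polynomial set" where
  "monomials = {Poly_Mapping.single e 1 | e. True}"

text \<open>
  An ideal of a commutative ring is a submodule of the ring, regarded as a module over itself.
\<close>

interpretation ring_module: module "(*) :: 'a::comm_ring_1 \<Rightarrow> 'a \<Rightarrow> 'a"
  by standard (simp_all add: algebra_simps)

abbreviation is_ideal :: "'a::comm_ring_1 set \<Rightarrow> bool" where
  "is_ideal \<equiv> module.subspace (*)"

abbreviation ideal_generated :: "'a::comm_ring_1 set \<Rightarrow> 'a set" where
  "ideal_generated \<equiv> module.span (*)"

definition monomial_ideal :: "('n, 'k::field) polynomial set \<Rightarrow> bool" where
  "monomial_ideal I \<longleftrightarrow> (\<exists>M \<subseteq> monomials. I = ideal_generated M)"

text \<open>
  The list \<open>ps\<close> consists of the pairs \<open>(i, j)\<close> of a move, with repetitions allowed. The polynomial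
  \<open>q\<close> is the quotient of \<open>m\<close> by the product of the \<open>poly_var j\<close> (unique, as the ring is a domain);
  its existence says that the product divides \<open>m\<close>.
\<close>

definition borel_move ::
    "('n::linorder, 'k::field) polynomial \<Rightarrow> ('n, 'k) polynomial \<Rightarrow> bool" where
  "borel_move m m' \<longleftrightarrow>
     (\<exists>ps q. (\<forall>(i, j) \<in> set ps. i < j) \<and>
             m = q * (\<Prod>(i, j) \<leftarrow> ps. poly_var j) \<and>
             m' = q * (\<Prod>(i, j) \<leftarrow> ps. poly_var i))"

definition strongly_stable :: "('n::linorder, 'k::field) polynomial set \<Rightarrow> bool" where
  "strongly_stable I \<longleftrightarrow>
     monomial_ideal I \<and> (\<forall>m \<in> I \<inter> monomials. \<forall>m'. borel_move m m' \<longrightarrow> m' \<in> I)"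

definition Borel ::
    "('n::linorder, 'k::field) polynomial set \<Rightarrow> ('n, 'k) polynomial set" where
  "Borel T = \<Inter>{I. strongly_stable I \<and> T \<subseteq> I}"

definition weight_vector :: "('n::{finite, linorder} \<Rightarrow> nat) \<Rightarrow> bool" where
  "weight_vector w \<longleftrightarrow> (\<forall>i. 0 < w i) \<and> antimono w"

text \<open>The map \<open>\<psi>\<close>: substitute \<open>y\<^sub>i ^ w\<^sub>i\<close> for \<open>x\<^sub>i\<close>.\<close>

definition weight_hom ::
    "('n::finite \<Rightarrow> nat) \<Rightarrow> ('n, 'k::field) polynomial \<Rightarrow> ('n, 'k) polynomial" where
  "weight_hom w f =
     (\<Sum>e \<in> Poly_Mapping.keys f.
        poly_const (Poly_Mapping.lookup f e) *
        (\<Prod>i \<in> UNIV. (poly_var i ^ w i) ^ Poly_Mapping.lookup e i))"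

definition weighted_closure ::
    "('n::{finite, linorder} \<Rightarrow> nat) \<Rightarrow> ('n, 'k::field) polynomial set \<Rightarrow> ('n, 'k) polynomial set"
  where
  "weighted_closure w A = weight_hom w -` Borel (weight_hom w ` A)"


subsection \<open>\<open>weight_hom w\<close> is the unique algebra homomorphism with \<open>x\<^sub>i \<mapsto> y\<^sub>i ^ w\<^sub>i\<close>\<close>

lemma polynomial_sum_terms:
  fixes f :: "('n, 'k::field) polynomial"
  shows "f = (\<Sum>e \<in> Poly_Mapping.keys f. poly_const (Poly_Mapping.lookup f e) * Poly_Mapping.single e 1)"
  by (rule poly_mapping_eqI)
    (auto simp: lookup_sum poly_const_def mult_single lookup_single when_def in_keys_iff)

lemma weight_hom_eq_sum:
  assumes "finite X" "Poly_Mapping.keys f \<subseteq> X"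
  shows "weight_hom w f = (\<Sum>e \<in> X. poly_const (Poly_Mapping.lookup f e) *
           (\<Prod>i \<in> UNIV. (poly_var i ^ w i) ^ Poly_Mapping.lookup e i))"
  unfolding weight_hom_def
  by (rule sum.mono_neutral_left) (use assms in \<open>auto simp: in_keys_iff poly_const_def\<close>)

lemma poly_const_add: "poly_const (a + b) = poly_const a + poly_const b"
  by (simp add: poly_const_def single_add)

lemma poly_const_mult: "poly_const (a * b) = poly_const a * poly_const b"
  by (simp add: poly_const_def mult_single)

lemma weight_hom_add: "weight_hom w (f + g) = weight_hom w f + weight_hom w g"
proof -
  let ?X = "Poly_Mapping.keys f \<union> Poly_Mapping.keys g"
  have "weight_hom w h = (\<Sum>e \<in> ?X. poly_const (Poly_Mapping.lookup h e) *
           (\<Prod>i \<in> UNIV. (poly_var i ^ w i) ^ Poly_Mapping.lookup e i))"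
    if "Poly_Mapping.keys h \<subseteq> ?X" for h
    using that by (intro weight_hom_eq_sum) auto
  from this[of f] this[of g] this[of "f + g"] show ?thesis
    using Poly_Mapping.keys_add[of f g]
    by (simp add: lookup_add poly_const_add distrib_right sum.distrib)
qed

lemma weight_hom_0: "weight_hom w 0 = 0"
  by (simp add: weight_hom_def)

lemma weight_hom_sum: "weight_hom w (sum F X) = (\<Sum>x \<in> X. weight_hom w (F x))"
  by (induction X rule: infinite_finite_induct) (simp_all add: weight_hom_0 weight_hom_add)

lemma weight_hom_single:
  "weight_hom w (Poly_Mapping.single e c) =
     poly_const c * (\<Prod>i \<in> UNIV. (poly_var i ^ w i) ^ Poly_Mapping.lookup e i)"
  by (subst weight_hom_eq_sum[of "{e}"]) auto

lemma weight_hom_const: "weight_hom w (poly_const c) = poly_const c"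
  unfolding poly_const_def[of c] by (subst weight_hom_single) (simp add: poly_const_def)

lemma weight_hom_var: "weight_hom w (poly_var i) = poly_var i ^ w i"
proof -
  have "(\<Prod>j \<in> UNIV. (poly_var j ^ w j) ^ Poly_Mapping.lookup (Poly_Mapping.single i 1) j) =
        (\<Prod>j \<in> UNIV. if j = i then poly_var i ^ w i else (1 :: ('a, 'b) polynomial))"
    by (rule prod.cong) (auto simp: lookup_single)
  then show ?thesis
    unfolding poly_var_def[of i] weight_hom_single by (simp add: poly_const_def flip: poly_var_def)
qed

lemma weight_hom_mult: "weight_hom w (f * g) = weight_hom w f * weight_hom w g"
proof -
  have single: "weight_hom w (Poly_Mapping.single d a * Poly_Mapping.single e b) =
      weight_hom w (Poly_Mapping.single d a) * weight_hom w (Poly_Mapping.single e b)" for d e a b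
    unfolding mult_single weight_hom_single poly_const_mult lookup_add power_add prod.distrib
    by (simp only: mult_ac)
  have terms: "h = (\<Sum>e \<in> Poly_Mapping.keys h. Poly_Mapping.single e (Poly_Mapping.lookup h e))"
    for h :: "('a, 'b) polynomial"
    by (rule poly_mapping_eqI) (auto simp: lookup_sum lookup_single when_def in_keys_iff)
  show ?thesis
    by (subst (1 2) terms[of f], subst (1 2) terms[of g])
      (simp only: sum_product weight_hom_sum single)
qed

lemma single_eq_prod_var:
  "(Poly_Mapping.single e 1 :: ('n::finite, 'k::field) polynomial) =
     (\<Prod>i \<in> UNIV. poly_var i ^ Poly_Mapping.lookup e i)"
proof -
  have pow: "(poly_var i :: ('n, 'k) polynomial) ^ k =
      Poly_Mapping.single (Poly_Mapping.single i k) 1" for i k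
    by (induction k) (simp_all add: poly_var_def mult_single flip: single_add)
  have prod: "(\<Prod>i \<in> X. Poly_Mapping.single (F i) 1 :: ('n, 'k) polynomial) =
      Poly_Mapping.single (\<Sum>i \<in> X. F i) 1" for X :: "'n set" and F
    by (induction X rule: infinite_finite_induct) (simp_all add: mult_single)
  have "(\<Sum>i \<in> UNIV. Poly_Mapping.single i (Poly_Mapping.lookup e i)) = e"
    by (rule poly_mapping_eqI) (simp add: lookup_sum lookup_single when_def)
  then show ?thesis by (simp add: pow prod)
qed

lemma weight_hom_unique:
  fixes h :: "('n::finite, 'k::field) polynomial \<Rightarrow> ('n, 'k) polynomial"
  assumes add: "\<And>f g. h (f + g) = h f + h g"
    and mult: "\<And>f g. h (f * g) = h f * h g"
    and const: "\<And>c. h (poly_const c) = poly_const c"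
    and var: "\<And>i. h (poly_var i) = poly_var i ^ w i"
  shows "h = weight_hom w"
proof
  fix f
  have zero: "h 0 = 0" using const[of 0] by (simp add: poly_const_def)
  have one: "h 1 = 1" using const[of 1] by (simp add: poly_const_def)
  have sum: "h (sum F X) = (\<Sum>x \<in> X. h (F x))" for F and X :: "('n \<Rightarrow>\<^sub>0 nat) set"
    by (induction X rule: infinite_finite_induct) (simp_all add: zero add)
  have prod: "h (prod F X) = (\<Prod>x \<in> X. h (F x))" for F and X :: "'n set"
    by (induction X rule: infinite_finite_induct) (simp_all add: one mult)
  have power: "h (g ^ k) = h g ^ k" for g k
    by (induction k) (simp_all add: one mult)
  show "h f = weight_hom w f"
    by (subst polynomial_sum_terms[of f])
      (simp add: sum mult const single_eq_prod_var prod power var weight_hom_def)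
qed


subsection \<open>\<open>Borel T\<close> is the smallest strongly stable ideal containing \<open>T\<close>\<close>

lemma monomial_ideal_altdef:
  "monomial_ideal I \<longleftrightarrow>
     is_ideal I \<and> (\<forall>f \<in> I. \<forall>e \<in> Poly_Mapping.keys f. Poly_Mapping.single e 1 \<in> I)"
  (is "_ \<longleftrightarrow> _ \<and> ?homogeneous I")
proof
  assume "monomial_ideal I"
  then obtain M where M: "M \<subseteq> monomials" and I: "I = ideal_generated M"
    by (auto simp: monomial_ideal_def)
  let ?H = "{f. \<forall>e \<in> Poly_Mapping.keys f. Poly_Mapping.single e 1 \<in> I}"
  have "is_ideal ?H"
  proof (rule ring_module.subspaceI)
    show "f + g \<in> ?H" if "f \<in> ?H" "g \<in> ?H" for f g
      using that Poly_Mapping.keys_add[of f g] by blast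
    show "c * f \<in> ?H" if f: "f \<in> ?H" for c f
    proof (clarify)
      fix e assume "e \<in> Poly_Mapping.keys (c * f)"
      then obtain a b where e: "e = a + b" and b: "b \<in> Poly_Mapping.keys f"
        using keys_mult[of c f] by blast
      have "Poly_Mapping.single a 1 * Poly_Mapping.single b 1 \<in> I"
        using f b unfolding I by (blast intro: ring_module.span_scale)
      then show "Poly_Mapping.single e 1 \<in> I" by (simp add: mult_single e)
    qed
  qed simp
  moreover have "M \<subseteq> ?H"
  proof
    fix m assume "m \<in> M"
    moreover from this M obtain e where "m = Poly_Mapping.single e 1" by (auto simp: monomials_def)
    ultimately show "m \<in> ?H" unfolding I by (auto intro: ring_module.span_base)
  qed
  ultimately have "I \<subseteq> ?H" unfolding I by (rule ring_module.span_minimal[rotated])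
  then show "is_ideal I \<and> ?homogeneous I" unfolding I by (auto simp: ring_module.subspace_span)
next
  assume I: "is_ideal I \<and> ?homogeneous I"
  have "I = ideal_generated (I \<inter> monomials)"
  proof
    show "ideal_generated (I \<inter> monomials) \<subseteq> I"
      using I by (intro ring_module.span_minimal) auto
    show "I \<subseteq> ideal_generated (I \<inter> monomials)"
    proof
      fix f assume "f \<in> I"
      then have "Poly_Mapping.single e 1 \<in> I \<inter> monomials" if "e \<in> Poly_Mapping.keys f" for e
        using I that by (auto simp: monomials_def)
      then have "(\<Sum>e \<in> Poly_Mapping.keys f. poly_const (Poly_Mapping.lookup f e) *
          Poly_Mapping.single e 1) \<in> ideal_generated (I \<inter> monomials)"
        by (intro ring_module.span_sum ring_module.span_scale ring_module.span_base)
      then show "f \<in> ideal_generated (I \<inter> monomials)"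
        by (simp flip: polynomial_sum_terms)
    qed
  qed
  then show "monomial_ideal I" by (auto simp: monomial_ideal_def)
qed

lemma strongly_stable_Borel: "strongly_stable (Borel T)"
proof -
  have "is_ideal (Borel T)"
    unfolding Borel_def
    by (rule ring_module.subspace_Inter) (auto simp: strongly_stable_def monomial_ideal_altdef)
  then have "monomial_ideal (Borel T)"
    unfolding monomial_ideal_altdef
    by (auto simp: Borel_def strongly_stable_def monomial_ideal_altdef)
  then show ?thesis
    unfolding strongly_stable_def by (auto simp: Borel_def strongly_stable_def)
qed

lemma subset_Borel: "T \<subseteq> Borel T"
  by (auto simp: Borel_def)

lemma Borel_least: "strongly_stable I \<Longrightarrow> T \<subseteq> I \<Longrightarrow> Borel T \<subseteq> I"
  by (auto simp: Borel_def)

lemma is_ideal_weighted_closure: "is_ideal (weighted_closure w A)"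
proof -
  have "is_ideal (Borel (weight_hom w ` A))"
    using strongly_stable_Borel by (auto simp: strongly_stable_def monomial_ideal_altdef)
  then show ?thesis
    unfolding weighted_closure_def ring_module.subspace_def
    by (auto simp: weight_hom_0 weight_hom_add weight_hom_mult)
qed

end

theory Submission
  imports Defs
begin

text \<open>
  A monomial occurring in an element of a sum of two monomial ideals lies in one of the two. Hence a
  sum of strongly stable ideals is strongly stable, so that \<open>Borel\<close> turns unions into sums. Since
  the weights are positive, \<open>weight_hom w\<close> maps distinct monomials to distinct monomials, so a
  polynomial whose image lies in a sum of two monomial ideals can be split term by term.
\<close>

lemma is_ideal_set_plus:
  assumes "is_ideal I" "is_ideal J"
  shows "is_ideal (I + J)"
proof (rule ring_module.subspaceI)
  show "0 \<in> I + J"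
    using set_plus_intro[OF assms[THEN ring_module.subspace_0]] by simp
  show "x + y \<in> I + J" if "x \<in> I + J" "y \<in> I + J" for x y
  proof -
    have "(a + b) + (c + d) \<in> I + J" if "a \<in> I" "b \<in> J" "c \<in> I" "d \<in> J" for a b c d
      \<comment> \<open>The rewriting regroups the sum as \<open>(a + c) + (b + d)\<close>, with one
        summand in each ideal.\<close>
      unfolding add.assoc add.left_commute[of b c d] unfolding add.assoc[symmetric, of a c]
      using assms that by (intro set_plus_intro ring_module.subspace_add)
    then show ?thesis
      using that by (metis set_plus_elim)
  qed
  show "c * x \<in> I + J" if "x \<in> I + J" for c x
    using that
  proof (rule set_plus_elim)
    fix a b assume "x = a + b" "a \<in> I" "b \<in> J"
    then show ?thesis
      using set_plus_intro[OF ring_module.subspace_scale[OF assms(1), of a c]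
          ring_module.subspace_scale[OF assms(2), of b c]]
      by (simp add: distrib_left)
  qed
qed

lemma subset_set_plus_ideals:
  assumes "is_ideal I" "is_ideal J"
  shows "I \<union> J \<subseteq> I + J"
  using set_zero_plus2[of J I] set_zero_plus2[of I J] assms[THEN ring_module.subspace_0]
  by (auto simp: add.commute)

text \<open>Adding polynomials creates no new exponents, so \<open>e\<close> already occurs in one
  of the two summands, and a monomial ideal contains every monomial of its elements.\<close>

lemma single_mem_set_plus:
  assumes "monomial_ideal I" "monomial_ideal J" "f \<in> I + J" "e \<in> Poly_Mapping.keys f"
  shows "Poly_Mapping.single e 1 \<in> I \<union> J"
proof -
  obtain g h where f: "f = g + h" and gh: "g \<in> I" "h \<in> J"
    using assms(3) by (rule set_plus_elim)
  then have "e \<in> Poly_Mapping.keys g \<union> Poly_Mapping.keys h"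
    using assms(4) Poly_Mapping.keys_add[of g h] by blast
  then show ?thesis
    using assms(1,2) gh by (auto simp: monomial_ideal_altdef)
qed

lemma strongly_stable_set_plus:
  assumes "strongly_stable I" "strongly_stable J"
  shows "strongly_stable (I + J)"
proof -
  have mono: "monomial_ideal I" "monomial_ideal J"
    using assms by (auto simp: strongly_stable_def)
  then have ideal: "is_ideal I" "is_ideal J"
    by (auto simp: monomial_ideal_altdef)
  note sub = subset_set_plus_ideals[OF ideal]
  have "monomial_ideal (I + J)"
    unfolding monomial_ideal_altdef
    using is_ideal_set_plus[OF ideal] single_mem_set_plus[OF mono] sub by blast
  moreover have "m' \<in> I + J" if m: "m \<in> (I + J) \<inter> monomials" "borel_move m m'" for m m'
  proof -
    obtain e where "m = Poly_Mapping.single e 1"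
      using m by (auto simp: monomials_def)
    \<comment> \<open>The only exponent of \<open>m\<close> is \<open>e\<close>, so the monomial
      itself lies in one of the two ideals, and that ideal absorbs the Borel move.\<close>
    then have "m \<in> I \<union> J"
      using single_mem_set_plus[OF mono, of m e] m by simp
    then show ?thesis
      using assms m sub unfolding strongly_stable_def by blast
  qed
  ultimately show ?thesis
    by (simp add: strongly_stable_def)
qed

lemma Borel_mono: "T \<subseteq> U \<Longrightarrow> Borel T \<subseteq> Borel U"
  by (auto simp: Borel_def)

lemma monomial_ideal_Borel: "monomial_ideal (Borel T)"
  using strongly_stable_Borel by (auto simp: strongly_stable_def)

lemma is_ideal_Borel: "is_ideal (Borel T)"
  using monomial_ideal_Borel by (auto simp: monomial_ideal_altdef)

text \<open>The left side is contained in the right by minimality, as the sum is strongly stable and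
  contains both sets; the converse is monotonicity together with closure under addition.\<close>

lemma Borel_Un: "Borel (T \<union> U) = Borel T + Borel U"
proof
  show "Borel (T \<union> U) \<subseteq> Borel T + Borel U"
    using subset_Borel[of T] subset_Borel[of U]
      subset_set_plus_ideals[OF is_ideal_Borel[of T] is_ideal_Borel[of U]]
    by (intro Borel_least strongly_stable_set_plus strongly_stable_Borel) blast
  show "Borel T + Borel U \<subseteq> Borel (T \<union> U)"
    using Borel_mono[of T "T \<union> U"] Borel_mono[of U "T \<union> U"]
    by (auto elim!: set_plus_elim intro!: ring_module.subspace_add[OF is_ideal_Borel])
qed

text \<open>The effect of \<open>weight_hom w\<close> on exponents. The index type is finite, so the
  function under \<open>Abs_poly_mapping\<close> automatically has finite support.\<close>

definition weighted_exponent :: "('n::finite \<Rightarrow> nat) \<Rightarrow> ('n \<Rightarrow>\<^sub>0 nat) \<Rightarrow> ('n \<Rightarrow>\<^sub>0 nat)" where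
  "weighted_exponent w e = Abs_poly_mapping (\<lambda>i. w i * Poly_Mapping.lookup e i)"

lemma lookup_weighted_exponent:
  "Poly_Mapping.lookup (weighted_exponent w e) i = w i * Poly_Mapping.lookup e i"
  by (simp add: weighted_exponent_def)

lemma inj_weighted_exponent:
  assumes "\<And>i. 0 < w i"
  shows "inj (weighted_exponent w)"
proof (rule injI, rule poly_mapping_eqI)
  fix d e i
  assume "weighted_exponent w d = weighted_exponent w e"
  then have "w i * Poly_Mapping.lookup d i = w i * Poly_Mapping.lookup e i"
    by (metis lookup_weighted_exponent)
  then show "Poly_Mapping.lookup d i = Poly_Mapping.lookup e i"
    using assms[of i] by simp
qed

lemma weight_hom_single_eq:
  "weight_hom w (Poly_Mapping.single e c) = Poly_Mapping.single (weighted_exponent w e) c"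
proof -
  have "weight_hom w (Poly_Mapping.single e c) =
      poly_const c * Poly_Mapping.single (weighted_exponent w e) 1"
    unfolding weight_hom_single single_eq_prod_var[of "weighted_exponent w e"]
    by (simp add: lookup_weighted_exponent power_mult)
  then show ?thesis
    by (simp add: poly_const_def mult_single)
qed

lemma polynomial_sum_singles:
  "(\<Sum>e \<in> Poly_Mapping.keys f. Poly_Mapping.single e (Poly_Mapping.lookup f e)) = f"
  by (rule poly_mapping_eqI) (auto simp: lookup_sum lookup_single when_def in_keys_iff)

text \<open>Distinct terms of \<open>f\<close> have images with distinct exponents, so nothing
  merges or cancels and each coefficient survives.\<close>

lemma lookup_weight_hom:
  assumes "\<And>i. 0 < w i"
  shows "Poly_Mapping.lookup (weight_hom w f) (weighted_exponent w e) = Poly_Mapping.lookup f e"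
proof -
  have "weight_hom w f = (\<Sum>d \<in> Poly_Mapping.keys f.
      Poly_Mapping.single (weighted_exponent w d) (Poly_Mapping.lookup f d))"
    by (subst polynomial_sum_singles[symmetric]) (simp only: weight_hom_sum weight_hom_single_eq)
  then show ?thesis
    using inj_weighted_exponent[of w, OF assms]
    by (auto simp: lookup_sum lookup_single when_def in_keys_iff inj_eq)
qed

text \<open>For an arbitrary ring homomorphism only the inclusion from right to left holds. The
  other one rests on the absence of cancellation between images of terms.\<close>

lemma vimage_weight_hom_set_plus:
  assumes w: "\<And>i. 0 < w i" and "monomial_ideal I" "monomial_ideal J"
  shows "weight_hom w -` (I + J) = weight_hom w -` I + weight_hom w -` J"
proof
  show "weight_hom w -` I + weight_hom w -` J \<subseteq> weight_hom w -` (I + J)"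
    by (auto elim!: set_plus_elim simp: weight_hom_add)
  show "weight_hom w -` (I + J) \<subseteq> weight_hom w -` I + weight_hom w -` J"
  proof
    fix f assume f: "f \<in> weight_hom w -` (I + J)"
    let ?t = "\<lambda>e. Poly_Mapping.single e (Poly_Mapping.lookup f e)"
    \<comment> \<open>Terms whose image lies in both ideals are assigned to the \<open>I\<close>
      part; every remaining term must then map into \<open>J\<close>.\<close>
    define X where "X = {e \<in> Poly_Mapping.keys f. weight_hom w (?t e) \<in> I}"
    have ideal: "is_ideal I" "is_ideal J"
      using assms(2,3) by (auto simp: monomial_ideal_altdef)
    \<comment> \<open>Membership is known for monomials with coefficient 1, whereas the terms of
      \<open>f\<close> carry arbitrary coefficients.\<close>
    have scale: "Poly_Mapping.single d c \<in> K"
      if "is_ideal K" "Poly_Mapping.single d 1 \<in> K" for K :: "('a, 'b) polynomial set" and d c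
      using ring_module.subspace_scale[OF that, of "poly_const c"]
      by (simp add: poly_const_def mult_single)
    have J: "weight_hom w (?t e) \<in> J" if "e \<in> Poly_Mapping.keys f - X" for e
    proof -
      \<comment> \<open>The coefficient here equals that of \<open>f\<close> at \<open>e\<close>,
        which is nonzero.\<close>
      have "weighted_exponent w e \<in> Poly_Mapping.keys (weight_hom w f)"
        using that by (simp add: in_keys_iff lookup_weight_hom[OF w])
      then have "Poly_Mapping.single (weighted_exponent w e) 1 \<in> I \<union> J"
        using single_mem_set_plus[OF assms(2,3)] f by blast
      then show ?thesis
        using that scale[OF ideal(1)] scale[OF ideal(2)]
        unfolding X_def weight_hom_single_eq by blast
    qed
    have in_I: "sum ?t X \<in> weight_hom w -` I"
      unfolding vimage_eq weight_hom_sum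
      by (rule ring_module.subspace_sum[OF ideal(1)]) (simp add: X_def)
    have in_J: "sum ?t (Poly_Mapping.keys f - X) \<in> weight_hom w -` J"
      unfolding vimage_eq weight_hom_sum
      by (rule ring_module.subspace_sum[OF ideal(2)]) (rule J)
    have "f = sum ?t X + sum ?t (Poly_Mapping.keys f - X)"
      using sum.subset_diff[of X "Poly_Mapping.keys f" ?t]
      unfolding polynomial_sum_singles by (simp add: X_def add.commute)
    then show "f \<in> weight_hom w -` I + weight_hom w -` J"
      by (rule ssubst) (rule set_plus_intro[OF in_I in_J])
  qed
qed

theorem proposition2p22:
  fixes w :: "'n::{finite, linorder} \<Rightarrow> nat"
    and A\<^sub>1 A\<^sub>2 I\<^sub>1 I\<^sub>2 :: "('n, 'k::field) polynomial set"
  assumes "weight_vector w"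
    and "A\<^sub>1 \<subseteq> monomials" and "A\<^sub>2 \<subseteq> monomials"
    and "I\<^sub>1 = weighted_closure w A\<^sub>1" and "I\<^sub>2 = weighted_closure w A\<^sub>2"
  shows "I\<^sub>1 + I\<^sub>2 = weighted_closure w (A\<^sub>1 \<union> A\<^sub>2)"
proof -
  have "\<And>i. 0 < w i"
    using assms(1) by (simp add: weight_vector_def)
  then show ?thesis
    unfolding assms(4,5) weighted_closure_def image_Un Borel_Un
    by (rule vimage_weight_hom_set_plus[symmetric, OF _ monomial_ideal_Borel monomial_ideal_Borel])
qed

end
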